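(* Let $B\subset(0,1)$ be closed and $\theta$-invariant. Then $B$ is invariant for some QMF function $p$ if and only if $$\overline{B_e}\cap(\overline{B_e})^\ast=\emptyset.$$
   Context: A QMF function is a nonnegative, continuous, $1$-periodic function $p:\mathbb{R}\to\mathbb{R}$ satisfying $p(\xi/2)+p(\xi/2+1/2)=1$ for every $\xi\in[0,1]$ and $p(0)=1$. To each QMF function $p$ one associates the Markov process $\xi_0,\xi_1,\xi_2,\dots$ on $[0,1]$ which, given $\xi_0\in[0,1]$, evolves by $\xi_{t+1}\in\{\xi_t/2,\ \xi_t/2+1/2\}$ with $\mathbb{P}_p(\xi_{t+1}=\xi_t/2+j/2\mid \xi_t)=p(\xi_t/2+j/2)$ for $j=0,1$. A set $B\subset[0,1]$ is invariant for $p$ if $\mathbb{P}_p(\xi_1\in B\mid\xi_0)=1$ for every $\xi_0\in B$. A set $B\subset(0,1)$ is $\theta$-invariant (invariant under multiplication by $2$ mod $1$) if, regarded as a subset of the circle $[0,1)$, it satisfies $B=\theta(B)$, where $\theta(\xi)=2\xi$ (mod $1$). "Closed" means closed as a subset of $\mathbb{R}$ (equivalently, of $[0,1]$). For $B\subset(0,1)$, put $B_e=\{\xi\in[0,1]\setminus B:\ \xi=\xi'/2+j/2 \text{ for some } \xi'\in B,\ j\in\{0,1\}\}$, and let $\overline{B_e}$ be its closure. For $\xi\in[0,1]$, define $\xi^\ast=\xi+1/2$ if $\xi\in[0,1/2]$ and $\xi^\ast=\xi-1/2$ if $\xi\in(1/2,1]$; for $E\subset[0,1]$, $E^\ast=\{\xi^\ast:\xi\in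 E\}$. *)

theory Defs
  imports "HOL-Analysis.Analysis" "HOL-Probability.Probability"
begin

definition QMF :: "(real \<Rightarrow> real) \<Rightarrow> bool" where
  "QMF p \<longleftrightarrow>
     (\<forall>\<xi>. 0 \<le> p \<xi>) \<and> continuous_on UNIV p \<and> (\<forall>\<xi>. p (\<xi> + 1) = p \<xi>) \<and>
     (\<forall>\<xi>\<in>{0..1}. p (\<xi>/2) + p (\<xi>/2 + 1/2) = 1) \<and> p 0 = 1"

text \<open>
  The conditional law of \<open>\<xi>\<^sub>t\<^sub>+\<^sub>1\<close> given \<open>\<xi>\<^sub>t = x\<close>. The coin shows \<open>j = 1\<close> with probability
  \<open>p (x/2 + 1/2)\<close>; that \<open>j = 0\<close> then has probability \<open>p (x/2)\<close> is due to the QMF equation,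
  see \<open>pmf_qmf_step\<close>. For \<open>p\<close> that are not QMF functions the value is meaningless, as
  \<^const>\<open>bernoulli_pmf\<close> truncates its argument to the unit interval.
\<close>

definition qmf_step :: "(real \<Rightarrow> real) \<Rightarrow> real \<Rightarrow> real pmf" where
  "qmf_step p x =
     map_pmf (\<lambda>j. x/2 + of_bool j / 2) (bernoulli_pmf (p (x/2 + 1/2)))"

lemma pmf_qmf_step:
  assumes "QMF p" "x \<in> {0..1}" "j \<in> {0, 1}"
  shows "pmf (qmf_step p x) (x/2 + j/2) = p (x/2 + j/2)"
proof -
  have inj: "inj (\<lambda>j. x/2 + of_bool j / 2)"
    by (auto simp: inj_on_def)
  have p: "0 \<le> p (x/2)" "0 \<le> p (x/2 + 1/2)" "p (x/2) + p (x/2 + 1/2) = 1"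
    using assms by (auto simp: QMF_def)
  have *: "pmf (qmf_step p x) (x/2 + of_bool b / 2) = pmf (bernoulli_pmf (p (x/2 + 1/2))) b" for b
    unfolding qmf_step_def using pmf_map_inj'[OF inj, of "bernoulli_pmf (p (x/2 + 1/2))" b] by simp
  from assms(3) consider "j = 0" | "j = 1" by auto
  then show ?thesis
    using *[of False] *[of True] p by cases auto
qed

lemma set_pmf_qmf_step: "set_pmf (qmf_step p x) \<subseteq> {x/2, x/2 + 1/2}"
  by (auto simp: qmf_step_def)

definition invariant_for :: "(real \<Rightarrow> real) \<Rightarrow> real set \<Rightarrow> bool" where
  "invariant_for p B \<longleftrightarrow>
     B \<subseteq> {0..1} \<and> (\<forall>x\<in>B. measure_pmf.prob (qmf_step p x) B = 1)"

definition theta :: "real \<Rightarrow> real" where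
  "theta \<xi> = frac (2 * \<xi>)"

definition theta_invariant :: "real set \<Rightarrow> bool" where
  "theta_invariant B \<longleftrightarrow> B = theta ` B"

definition exits :: "real set \<Rightarrow> real set" where
  "exits B = {\<xi> \<in> {0..1} - B. \<exists>\<xi>'\<in>B. \<exists>j\<in>{0, 1}. \<xi> = \<xi>'/2 + j/2}"

definition star :: "real \<Rightarrow> real" where
  "star \<xi> = (if \<xi> \<le> 1/2 then \<xi> + 1/2 else \<xi> - 1/2)"

end

(*
  If B is invariant for p, then p vanishes on exits B, hence on its closure, while
  p x + p (star x) = 1 forbids two zeros at x and star x.  Conversely, let A be the
  1-periodic extension of closure (exits B) together with 1/2.  This is a closed set disjoint
  from its translate by 1/2, and with d the distance to A the function
  d x / (d x + d (x + 1/2)) is a QMF function vanishing on A.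
*)
theory Submission
  imports Defs
begin

text \<open>Used to pass the period of a set on to its distance function.\<close>

lemma infdist_translate:
  fixes x c :: "'a::real_normed_vector"
  shows "infdist (x + c) ((\<lambda>y. y + c) ` S) = infdist x S"
  by (simp add: infdist_def image_image dist_norm)

lemma QMF_add_half:
  assumes "QMF p" "0 \<le> x" "x \<le> 1/2"
  shows "p x + p (x + 1/2) = 1"
proof -
  have "2 * x \<in> {0..1}" using assms by auto
  then have "p (2 * x / 2) + p (2 * x / 2 + 1/2) = 1"
    using assms(1) unfolding QMF_def by blast
  then show ?thesis by simp
qed

text \<open>The points \<open>x\<close> and \<open>star x\<close> are, in some order,
  \<open>y/2\<close> and \<open>y/2 + 1/2\<close> for some \<open>y\<close> in the unit interval, so
  the QMF equation applies to the pair.\<close>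

lemma QMF_star:
  assumes "QMF p" "x \<in> {0..1}"
  shows "p x + p (star x) = 1"
  using QMF_add_half[OF assms(1), of x] QMF_add_half[OF assms(1), of "x - 1/2"] assms(2)
  by (auto simp: star_def add.commute)

lemma exits_subset_unit: "exits B \<subseteq> {0..1}"
  by (auto simp: exits_def)

lemma closure_exits_subset_unit: "closure (exits B) \<subseteq> {0..1}"
  using exits_subset_unit by (rule closure_minimal) simp

text \<open>The chain can leave \<open>B\<close> in one step only by landing on a point of
  \<open>exits B\<close>, and it lands there with probability \<open>p\<close> of that point. This
  turns invariance into a condition on the zeros of \<open>p\<close>.\<close>

lemma invariant_for_iff_zero_on_exits:
  assumes p: "QMF p" and B: "B \<subseteq> {0..1}"
  shows "invariant_for p B \<longleftrightarrow> (\<forall>x\<in>exits B. p x = 0)"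
proof -
  have "measure_pmf.prob (qmf_step p x) B = 1 \<longleftrightarrow>
      (\<forall>j\<in>{0, 1}. x/2 + j/2 \<notin> B \<longrightarrow> p (x/2 + j/2) = 0)" if "x \<in> B" for x
  proof -
    have x: "x \<in> {0..1}" using that B by blast
    have *: "x/2 + j/2 \<in> set_pmf (qmf_step p x) \<longleftrightarrow> p (x/2 + j/2) \<noteq> 0" if "j \<in> {0, 1}" for j
      by (simp only: set_pmf_iff pmf_qmf_step[OF p x that])
    \<comment> \<open>The law is discrete, so full mass on \<open>B\<close> means that its support
      lies in \<open>B\<close>.\<close>
    have "measure_pmf.prob (qmf_step p x) B = 1 \<longleftrightarrow> set_pmf (qmf_step p x) \<subseteq> B"
      by (subst measure_pmf.prob_eq_1) (auto simp: AE_measure_pmf_iff)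
    also have "\<dots> \<longleftrightarrow> (\<forall>j\<in>{0, 1}. x/2 + j/2 \<in> set_pmf (qmf_step p x) \<longrightarrow> x/2 + j/2 \<in> B)"
      using set_pmf_qmf_step[of p x] by auto
    finally show ?thesis using * by blast
  qed
  then have "invariant_for p B \<longleftrightarrow>
      (\<forall>x\<in>B. \<forall>j\<in>{0, 1}. x/2 + j/2 \<notin> B \<longrightarrow> p (x/2 + j/2) = 0)"
    using B by (simp add: invariant_for_def)
  also have "\<dots> \<longleftrightarrow> (\<forall>x\<in>exits B. p x = 0)"
  proof -
    have "x/2 + j/2 \<in> {0..1}" if "x \<in> B" "j \<in> {0, 1}" for x j
      using that(2) subsetD[OF B that(1)] by auto
    then show ?thesis unfolding exits_def by blast
  qed
  finally show ?thesis .
qed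

lemma QMF_zero_on_closure:
  assumes "QMF p" "\<forall>x\<in>S. p x = 0" "x \<in> closure S"
  shows "p x = 0"
proof -
  have "closed {x. p x = 0}"
    using assms(1) by (intro closed_Collect_eq) (auto simp: QMF_def)
  then have "closure S \<subseteq> {x. p x = 0}"
    using assms(2) by (intro closure_minimal) auto
  then show ?thesis using assms(3) by blast
qed

text \<open>The two inverse branches of doubling send the compact set \<open>B\<close> onto compact
  subsets of (0,1/2) and (1/2,1). Limits of exit points therefore stay away from 0, 1/2 and 1, the
  points where \<open>star\<close> differs from a half turn of the circle or where
  \<open>p 0 = 1\<close> interferes.\<close>

lemma closure_exits_subset:
  assumes "B \<subseteq> {0<..<1}" "closed B"
  shows "closure (exits B) \<subseteq> {0<..<1} - {1/2}"
proof -
  let ?K = "(\<lambda>x. x/2) ` B \<union> (\<lambda>x. x/2 + 1/2) ` B"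
  have "bounded B" by (rule bounded_subset[OF _ assms(1)]) simp
  then have "compact B" using assms(2) by (simp add: compact_eq_bounded_closed)
  then have "compact ?K"
    by (intro compact_Un compact_continuous_image continuous_intros) auto
  then have "closed ?K" by (rule compact_imp_closed)
  then have "closure (exits B) \<subseteq> ?K"
    by (rule closure_minimal[rotated]) (auto simp: exits_def)
  also have "?K \<subseteq> {0<..<1} - {1/2}"
    using assms(1) by fastforce
  finally show ?thesis .
qed

text \<open>Disjointness of \<open>A\<close> from its half translate keeps the quotient of distances
  well defined, and \<open>1/2\<close> is put into \<open>A\<close> to force the value 1 at
  0.\<close>

lemma QMF_of_zero_set:
  fixes A :: "real set"
  assumes "closed A" "1/2 \<in> A" "\<And>x. x + 1 \<in> A \<longleftrightarrow> x \<in> A" "\<And>x. x \<in> A \<Longrightarrow> x + 1/2 \<notin> A"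
  obtains p where "QMF p" "\<And>x. x \<in> A \<Longrightarrow> p x = 0"
proof
  define d where "d x = infdist x A" for x
  define p where "p x = d x / (d x + d (x + 1/2))" for x
  have A: "(\<lambda>y. y + 1) ` A = A"
  proof
    show "(\<lambda>y. y + 1) ` A \<subseteq> A" using assms(3) by blast
    show "A \<subseteq> (\<lambda>y. y + 1) ` A"
    proof
      fix y assume "y \<in> A"
      then have "y - 1 \<in> A" using assms(3)[of "y - 1"] by simp
      then show "y \<in> (\<lambda>y. y + 1) ` A" by (rule rev_image_eqI) simp
    qed
  qed
  \<comment> \<open>Since \<open>infdist\<close> to the empty set is 0 by convention, the member
    \<open>1/2\<close> of \<open>A\<close> matters here as well as closedness.\<close>
  have d0: "d x = 0 \<longleftrightarrow> x \<in> A" for x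
    unfolding d_def using assms(1,2) in_closed_iff_infdist_zero[of A x] by blast
  have d_nonneg: "d x \<ge> 0" for x by (simp add: d_def infdist_nonneg)
  have d_periodic: "d (x + 1) = d x" for x
    unfolding d_def using infdist_translate[of x 1 A] A by simp
  have pos: "d x + d (x + 1/2) > 0" for x
    using d0[of x] d0[of "x + 1/2"] d_nonneg[of x] d_nonneg[of "x + 1/2"] assms(4)[of x]
    by linarith
  \<comment> \<open>A second half translate only swaps the summands of the denominator, so
    \<open>p x\<close> and \<open>p (x + 1/2)\<close> are fractions over the same
    denominator.\<close>
  have d_periodic': "d (x + 1/2 + 1/2) = d x" for x
    using d_periodic[of x] by (simp add: add.assoc)
  have sum: "p x + p (x + 1/2) = 1" for x
    unfolding p_def d_periodic' using pos[of x] by (simp add: add.commute[of "d (x + 1/2)"] flip: add_divide_distrib)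
  have "continuous_on UNIV p"
    unfolding p_def d_def
    using pos by (intro continuous_intros) (simp add: d_def less_imp_neq[symmetric])
  moreover have "p (x + 1) = p x" for x
    using d_periodic[of x] d_periodic[of "x + 1/2"] by (simp add: p_def algebra_simps)
  moreover have "p 0 = 1"
    using sum[of 0] d0[of "1/2"] assms(2) by (simp add: p_def)
  ultimately show "QMF p"
    using sum d_nonneg by (auto simp: QMF_def p_def)
  show "p x = 0" if "x \<in> A" for x using that d0 by (simp add: p_def)
qed

theorem mainTheorem2:
  fixes B :: "real set"
  assumes "B \<subseteq> {0<..<1}" and "closed B" and "theta_invariant B"
  shows "(\<exists>p. QMF p \<and> invariant_for p B) \<longleftrightarrow>
         closure (exits B) \<inter> star ` closure (exits B) = {}"
proof
  let ?C = "closure (exits B)"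
  have B: "B \<subseteq> {0..1}" using assms(1) by force
  show "?C \<inter> star ` ?C = {}" if "\<exists>p. QMF p \<and> invariant_for p B"
  proof -
    from that obtain p where p: "QMF p" "\<forall>x\<in>exits B. p x = 0"
      using invariant_for_iff_zero_on_exits[OF _ B] by blast
    have "star x \<notin> ?C" if "x \<in> ?C" for x
      using QMF_star[OF p(1), of x] QMF_zero_on_closure[OF p] that closure_exits_subset_unit[of B]
      by fastforce
    then show ?thesis by blast
  qed
  show "\<exists>p. QMF p \<and> invariant_for p B" if disj: "?C \<inter> star ` ?C = {}"
  proof -
    define S where "S = insert (1/2) ?C"
    have C: "?C \<subseteq> {0<..<1} - {1/2}" by (rule closure_exits_subset[OF assms(1,2)])
    define A where "A = (\<Union>a\<in>S. \<Union>n\<in>\<int>. {a + n})"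
    have S: "S \<subseteq> A"
    proof
      fix a assume "a \<in> S"
      moreover have "a = a + 0" "0 \<in> \<int>" by auto
      ultimately show "a \<in> A" unfolding A_def by blast
    qed
    have "bounded S"
      unfolding S_def using bounded_subset[OF bounded_closed_interval closure_exits_subset_unit[of B]]
      by simp
    \<comment> \<open>A sum of two closed sets may fail to be closed; compactness of
      \<open>S\<close> makes its sum with the integers closed.\<close>
    then have "compact S" by (simp add: S_def compact_eq_bounded_closed)
    then have "closed A"
      unfolding A_def by (rule compact_closed_sums) simp
    moreover have "1/2 \<in> A"
      using S by (simp add: S_def)
    moreover have "x + 1 \<in> A \<longleftrightarrow> x \<in> A" for x
    proof
      show "x \<in> A" if "x + 1 \<in> A"
      proof -
        from that obtain a n where "a \<in> S" "n \<in> \<int>" "x + 1 = a + n" unfolding A_def by blast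
        then have "x = a + (n - 1)" "n - 1 \<in> \<int>" by auto
        with \<open>a \<in> S\<close> show ?thesis unfolding A_def by blast
      qed
      show "x + 1 \<in> A" if "x \<in> A"
      proof -
        from that obtain a n where "a \<in> S" "n \<in> \<int>" "x = a + n" unfolding A_def by blast
        then have "x + 1 = a + (n + 1)" "n + 1 \<in> \<int>" by auto
        with \<open>a \<in> S\<close> show ?thesis unfolding A_def by blast
      qed
    qed
    moreover have "x + 1/2 \<notin> A" if "x \<in> A" for x
    proof
      assume "x + 1/2 \<in> A"
      then obtain b m where b: "b \<in> S" "x + 1/2 = b + of_int m"
        unfolding A_def by (auto elim: Ints_cases)
      obtain a n where a: "a \<in> S" "x = a + of_int n"
        using \<open>x \<in> A\<close> unfolding A_def by (auto elim: Ints_cases)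
      have ab: "0 < a" "a < 1" "0 < b" "b < 1" using a(1) b(1) C unfolding S_def by auto
      \<comment> \<open>As \<open>b - a\<close> lies strictly between -1 and 1, the integer
        \<open>n - m\<close> lies in (-3/2, 1/2), which leaves only 0 and -1.\<close>
      have "b = a + 1/2 + of_int (n - m)" using a(2) b(2) by simp
      moreover from this ab have "-2 < real_of_int (n - m)" "real_of_int (n - m) < 1" by linarith+
      then have "n - m = 0 \<or> n - m = -1" by linarith
      ultimately have "b = a + 1/2 \<or> b = a - 1/2" by (auto simp: algebra_simps)
      \<comment> \<open>If either of \<open>a\<close>, \<open>b\<close> were \<open>1/2\<close>, the
        other would be 0 or 1, outside the open interval. So both come from the closure of
        \<open>exits B\<close>, and the disjointness hypothesis applies.\<close>
      then have "b = star a" "a \<noteq> 1/2" "b \<noteq> 1/2" using ab by (auto simp: star_def)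
      with a(1) b(1) disj show False unfolding S_def by blast
    qed
    ultimately obtain p where p: "QMF p" "\<And>x. x \<in> A \<Longrightarrow> p x = 0"
      using QMF_of_zero_set by blast
    have "exits B \<subseteq> A"
      using S closure_subset[of "exits B"] by (auto simp: S_def)
    then show ?thesis
      using p invariant_for_iff_zero_on_exits[OF p(1) B] by blast
  qed
qed

end
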